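(* Let $A,B\in S_d^{++}(\mathbb{R})$, $\Sigma\in S_{2d}^{++}(\mathbb{R})$ and $\varepsilon>0$. Let $\Gamma_{12}$ be the upper-right $d\times d$ block of $\Sigma^{-1}$ and suppose that $M_\varepsilon:=I_d-\varepsilon\Gamma_{12}$ is invertible. Consider the dual problem $$\max_{(F,G)\in S_d^{++}(\mathbb{R})\times S_d^{++}(\mathbb{R})}\left\{\langle I_d-F,A\rangle_{\mathrm{HS}}+\langle I_d-G,B\rangle_{\mathrm{HS}}+\varepsilon\log\det\begin{pmatrix}F&-M_\varepsilon\\-M_\varepsilon^T&G\end{pmatrix}\right\}.$$ The optimal dual variables (the maximizer) $(F_\varepsilon^\star,G_\varepsilon^\star)$ are given by $$F_\varepsilon^\star=A^{-1}\left(\frac{\varepsilon}{2}I_d+\left(AM_\varepsilon BM_\varepsilon^T+\frac{\varepsilon^2}{4}I_d\right)^{1/2}\right),\qquad G_\varepsilon^\star=B^{-1}\left(\frac{\varepsilon}{2}I_d+\left(BM_\varepsilon^TAM_\varepsilon+\frac{\varepsilon^2}{4}I_d\right)^{1/2}\right).$$ Moreover, $G_\varepsilon^\star$ can be expressed as a function of $F_\varepsilon^\star$ through $$G_\varepsilon^\star=\varepsilon B^{-1}+M_\varepsilon^T(F_\varepsilon^\star)^{-1}M_\varepsilon.$$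
   Context: $S_{k}^{++}(\mathbb{R})$ is the set of real symmetric positive-definite $k\times k$ matrices; $\langle P,Q\rangle_{\mathrm{HS}}:=\mathrm{tr}(PQ^T)$. In the dual problem, $\log\det$ of a symmetric matrix that is not positive-definite is taken to be $-\infty$. Square roots of the (not necessarily symmetric) matrices are defined by $$\left(AM_\varepsilon BM_\varepsilon^T+\tfrac{\varepsilon^2}{4}I_d\right)^{1/2}:=A^{1/2}\left(A^{1/2}M_\varepsilon BM_\varepsilon^TA^{1/2}+\tfrac{\varepsilon^2}{4}I_d\right)^{1/2}A^{-1/2},$$ $$\left(BM_\varepsilon^TAM_\varepsilon+\tfrac{\varepsilon^2}{4}I_d\right)^{1/2}:=B^{1/2}\left(B^{1/2}M_\varepsilon^TAM_\varepsilon B^{1/2}+\tfrac{\varepsilon^2}{4}I_d\right)^{1/2}B^{-1/2},$$ where the square roots on the right are the usual positive-definite square roots of symmetric positive-definite matrices. (This is the dual, up to an additive constant, of minimizing $\int\|x-y\|^2d\pi+2\varepsilon\,\mathrm{KL}(\pi|N_{2d}(\Sigma))$ over couplings $\pi$ of the centered Gaussians $N_d(A)$ and $N_d(B)$.) *)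

theory Defs
  imports "HOL-Analysis.Analysis"
begin

definition pos_def :: "real^'n^'n \<Rightarrow> bool" where
  "pos_def P \<longleftrightarrow> transpose P = P \<and> (\<forall>x. x \<noteq> 0 \<longrightarrow> x \<bullet> (P *v x) > 0)"

definition hs_inner :: "real^'n^'m \<Rightarrow> real^'n^'m \<Rightarrow> real" where
  "hs_inner P Q = trace (P ** transpose Q)"

text \<open>The usual positive-definite square root; meaningful only for positive-definite \<open>P\<close>.\<close>

definition pd_sqrt :: "real^'n^'n \<Rightarrow> real^'n^'n" where
  "pd_sqrt P = (THE S. pos_def S \<and> S ** S = P)"

text \<open>
  The square root \<open>(P C + t I)\<^sup>1\<^sup>/\<^sup>2 = P\<^sup>1\<^sup>/\<^sup>2 (P\<^sup>1\<^sup>/\<^sup>2 C P\<^sup>1\<^sup>/\<^sup>2 + t I)\<^sup>1\<^sup>/\<^sup>2 P\<^sup>-\<^sup>1\<^sup>/\<^sup>2\<close> of a matrix that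
  need not be symmetric. It takes the factors \<open>P\<close> and \<open>C\<close> separately: \<open>P\<close> is positive-definite,
  \<open>C\<close> is symmetric positive-semidefinite, and \<open>t > 0\<close>.
\<close>

definition prod_shift_sqrt :: "real^'n^'n \<Rightarrow> real^'n^'n \<Rightarrow> real \<Rightarrow> real^'n^'n" where
  "prod_shift_sqrt P C t =
     pd_sqrt P ** pd_sqrt (pd_sqrt P ** C ** pd_sqrt P + t *\<^sub>R mat 1) ** matrix_inv (pd_sqrt P)"

text \<open>
  Matrices of size \<open>2d\<close> are indexed by the sum type \<open>'n + 'n\<close>, where \<open>d = CARD('n)\<close>:
  \<open>Inl\<close> gives the first \<open>d\<close> coordinates and \<open>Inr\<close> the last \<open>d\<close>.
\<close>

definition block_matrix ::
  "real^'n^'n \<Rightarrow> real^'n^'n \<Rightarrow> real^'n^'n \<Rightarrow> real^'n^'n \<Rightarrow> real^('n + 'n)^('n + 'n)" where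
  "block_matrix P Q R S = (\<chi> i j. case (i, j) of
       (Inl k, Inl l) \<Rightarrow> P $ k $ l
     | (Inl k, Inr l) \<Rightarrow> Q $ k $ l
     | (Inr k, Inl l) \<Rightarrow> R $ k $ l
     | (Inr k, Inr l) \<Rightarrow> S $ k $ l)"

definition upper_right_block :: "real^('n + 'n)^('n + 'n) \<Rightarrow> real^'n^'n" where
  "upper_right_block T = (\<chi> i j. T $ Inl i $ Inr j)"

definition log_det :: "real^'n^'n \<Rightarrow> ereal" where
  "log_det P = (if pos_def P then ereal (ln (det P)) else -\<infinity>)"

definition dual_objective ::
  "real^'n^'n \<Rightarrow> real^'n^'n \<Rightarrow> real^'n^'n \<Rightarrow> real \<Rightarrow> (real^'n^'n) \<times> (real^'n^'n) \<Rightarrow> ereal" where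
  "dual_objective A B M \<epsilon> = (\<lambda>(F, G).
     ereal (hs_inner (mat 1 - F) A) + ereal (hs_inner (mat 1 - G) B)
       + ereal \<epsilon> * log_det (block_matrix F (- M) (- transpose M) G))"

end

theory Submission
  imports Defs
begin

text \<open>
  The dual objective is, up to a constant, \<open>X \<mapsto> - tr (diag(A, B) X) + \<epsilon> log det X\<close> restricted to the
  affine space of block matrices \<open>X\<close> with off-diagonal blocks \<open>- M\<close> and \<open>- M\<^sup>T\<close>. Since \<open>log det\<close> is
  strictly concave on the positive-definite cone and has gradient \<open>Y\<^sup>-\<^sup>1\<close> at \<open>Y\<close>, any positive-definite \<open>Y\<close> in
  that space for which \<open>\<epsilon> Y\<^sup>-\<^sup>1\<close> has diagonal blocks \<open>A\<close> and \<open>B\<close> is the unique maximizer: moving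
  within the space changes only the diagonal blocks, so the linear term cancels the first-order
  change of \<open>\<epsilon> log det\<close> exactly. This is \<open>dual_objective_less_critical\<close>, which rests on the
  tangent-plane inequality \<open>ln_det_less_tangent\<close>.

  By block inversion, the critical-point condition reduces to the Schur complement relation
  \<open>G = \<epsilon> B\<^sup>-\<^sup>1 + M\<^sup>T F\<^sup>-\<^sup>1 M\<close> together with the Riccati equation \<open>F A F = \<epsilon> F + M B M\<^sup>T\<close>
  (\<open>matrix_inv_block_critical\<close>), and the Schur complement being \<open>\<epsilon> B\<^sup>-\<^sup>1\<close> makes \<open>Y\<close> positive-definite
  (\<open>pos_def_block_matrix_Schur\<close>). Completing the square in the Riccati equation after conjugation
  by \<open>A\<^sup>1\<^sup>/\<^sup>2\<close> gives \<open>(A\<^sup>1\<^sup>/\<^sup>2 F A\<^sup>1\<^sup>/\<^sup>2 - \<epsilon>/2)\<^sup>2 = A\<^sup>1\<^sup>/\<^sup>2 M B M\<^sup>T A\<^sup>1\<^sup>/\<^sup>2 + \<epsilon>\<^sup>2/4\<close>, which is where the closed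
  form of \<open>F\<close> comes from (\<open>Riccati_solution\<close>). The matrix \<open>\<epsilon> B\<^sup>-\<^sup>1 + M\<^sup>T F\<^sup>-\<^sup>1 M\<close> solves the mirrored
  Riccati equation \<open>G B G = \<epsilon> G + M\<^sup>T A M\<close>, and uniqueness of positive-definite square roots
  identifies it with the closed form of \<open>G\<close> (\<open>Riccati_solution_unique\<close>, \<open>Riccati_dual_solution\<close>).

  Existence of square roots and the inequality \<open>log det W \<le> tr W - n\<close> behind the tangent-plane
  inequality are both read off from the spectral theorem for real symmetric matrices.
\<close>

section \<open>Matrix arithmetic\<close>

lemma matrix_add_rdistrib:
  fixes A B :: "'a::semiring_1^'n^'m"
  shows "(A + B) ** C = A ** C + B ** C"
  by (simp add: matrix_matrix_mult_def vec_eq_iff sum.distrib distrib_right)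

lemma transpose_add: "transpose (A + B) = transpose A + transpose B"
  by (simp add: transpose_def vec_eq_iff)

lemma transpose_uminus: "transpose (- A) = - transpose A"
  by (simp add: transpose_def vec_eq_iff)

lemma matrix_mul_uminus:
  fixes A :: "'a::ring_1^'n^'m"
  shows "(- A) ** B = - (A ** B)" "A ** (- B) = - (A ** B)"
  by (simp_all add: matrix_matrix_mult_def vec_eq_iff sum_negf)

lemma matrix_vector_mult_uminus:
  fixes A :: "'a::ring_1^'n^'m"
  shows "(- A) *v x = - (A *v x)"
  by (simp add: matrix_vector_mult_def vec_eq_iff sum_negf)

lemmas mat_distribs = matrix_add_ldistrib matrix_add_rdistrib matrix_scalar_ac
  scalar_matrix_assoc[symmetric]

lemma symmetric_inner_swap:
  fixes A :: "real^'n^'n"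
  assumes "transpose A = A"
  shows "x \<bullet> (A *v y) = (A *v x) \<bullet> y"
  using assms by (metis dot_lmul_matrix transpose_matrix_vector)

lemma inner_transpose_mult:
  fixes A :: "real^'m^'n"
  shows "x \<bullet> (transpose A *v y) = (A *v x) \<bullet> y"
  by (metis dot_lmul_matrix vector_transpose_matrix)

lemma matrix_inv_right: "invertible A \<Longrightarrow> A ** matrix_inv A = mat 1"
  and matrix_inv_left: "invertible A \<Longrightarrow> matrix_inv A ** A = mat 1"
proof -
  assume "invertible A"
  then have "A ** matrix_inv A = mat 1 \<and> matrix_inv A ** A = mat 1"
    unfolding invertible_def matrix_inv_def by (rule someI_ex)
  then show "A ** matrix_inv A = mat 1" "matrix_inv A ** A = mat 1" by simp_all
qed

lemma matrix_inv_eqI: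
  fixes A B :: "real^'n^'n"
  assumes "A ** B = mat 1" shows "matrix_inv A = B"
proof -
  have "invertible A" using assms by (auto simp: invertible_right_inverse)
  then have "matrix_inv A ** (A ** B) = B" by (simp add: matrix_mul_assoc matrix_inv_left)
  then show ?thesis by (simp add: assms)
qed

lemma matrix_inv_cancel_left:
  fixes A :: "real^'n^'n" and X :: "real^'m^'n"
  assumes "invertible A"
  shows "matrix_inv A ** (A ** X) = X" "A ** (matrix_inv A ** X) = X"
  using assms by (simp_all add: matrix_mul_assoc matrix_inv_left matrix_inv_right)

section \<open>The spectral theorem for real symmetric matrices\<close>

text \<open>
  The quadratic form of \<open>A\<close> attains its maximum \<open>l\<close> on the unit sphere of \<open>S\<close> at some \<open>v\<close>. Then
  \<open>q y = l \<parallel>y\<parallel>\<^sup>2 - y \<bullet> A y\<close> is nonnegative on \<open>S\<close> and vanishes at \<open>v\<close>, so its derivative at \<open>v\<close> in the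
  direction \<open>w = l v - A v\<close>, which is \<open>2 \<parallel>w\<parallel>\<^sup>2\<close>, must vanish.
\<close>

lemma symmetric_unit_eigenvector:
  fixes A :: "real^'n^'n"
  assumes sym: "transpose A = A" and S: "subspace S" "S \<noteq> {0}"
    and inv: "\<And>x. x \<in> S \<Longrightarrow> A *v x \<in> S"
  obtains v l where "v \<in> S" "norm v = 1" "A *v v = l *\<^sub>R v"
proof -
  define K where "K = sphere 0 1 \<inter> S"
  have "0 \<in> S" using S(1) by (rule subspace_0)
  then obtain x where x: "x \<in> S" "x \<noteq> 0" using S(2) by blast
  have "(1 / norm x) *\<^sub>R x \<in> K"
    using x S(1) by (auto simp: K_def subspace_scale)
  moreover have "compact K"
    unfolding K_def by (intro compact_Int_closed compact_sphere closed_subspace S)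
  moreover have "continuous_on K (\<lambda>x. x \<bullet> (A *v x))"
    by (intro continuous_intros linear_continuous_on matrix_vector_mul_bounded_linear)
  ultimately obtain v where v: "v \<in> K" and
    max: "\<And>y. y \<in> K \<Longrightarrow> y \<bullet> (A *v y) \<le> v \<bullet> (A *v v)"
    using continuous_attains_sup[of K "\<lambda>x. x \<bullet> (A *v x)"] by blast
  have vS: "v \<in> S" and nv: "norm v = 1" using v by (auto simp: K_def)
  define l where "l = v \<bullet> (A *v v)"
  define q where "q = (\<lambda>y. l * (y \<bullet> y) - y \<bullet> (A *v y))"
  have q_nonneg: "q y \<ge> 0" if "y \<in> S" for y
  proof (cases "y = 0")
    case False
    define u where "u = (1 / norm y) *\<^sub>R y"
    have "u \<in> K" using that S(1) False by (auto simp: K_def u_def subspace_scale)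
    then have "u \<bullet> (A *v u) \<le> l" using max l_def by simp
    moreover have "y = norm y *\<^sub>R u" using False by (simp add: u_def)
    then have "y \<bullet> (A *v y) = (norm y)\<^sup>2 * (u \<bullet> (A *v u))"
      by (metis inner_scaleR_left inner_scaleR_right matrix_vector_mult_scaleR mult.assoc power2_eq_square)
    ultimately show ?thesis
      by (simp add: q_def power2_norm_eq_inner[symmetric] mult.commute[of l] mult_left_mono)
  qed (simp add: q_def)
  define w where "w = l *\<^sub>R v - A *v v"
  have wS: "w \<in> S" using vS inv S(1) by (simp add: w_def subspace_diff subspace_scale)
  have qv: "q v = 0" using nv by (simp add: q_def l_def norm_eq_1)
  have "q (v + t *\<^sub>R w) = 2 * t * (w \<bullet> w) + t\<^sup>2 * q w" for t
  proof -
    have s: "v \<bullet> (A *v w) = w \<bullet> (A *v v)"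
      using symmetric_inner_swap[OF sym] by (metis inner_commute)
    have "q (v + t *\<^sub>R w) = q v + 2 * t * (l * (v \<bullet> w) - w \<bullet> (A *v v)) + t\<^sup>2 * q w"
      by (simp add: q_def inner_add_left inner_add_right matrix_vector_right_distrib
          matrix_vector_mult_scaleR s inner_commute[of w v] power2_eq_square algebra_simps)
    moreover have "l * (v \<bullet> w) - w \<bullet> (A *v v) = w \<bullet> w"
      by (simp add: w_def inner_diff_left inner_diff_right inner_commute algebra_simps)
    ultimately show ?thesis using qv by simp
  qed
  then have quad: "0 \<le> 2 * t * (w \<bullet> w) + t\<^sup>2 * q w" for t
    using q_nonneg[of "v + t *\<^sub>R w"] vS wS S(1) by (simp add: subspace_add subspace_scale)
  have "w \<bullet> w = 0"
  proof (rule ccontr)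
    assume "w \<bullet> w \<noteq> 0"
    then have ww: "w \<bullet> w > 0" by simp
    have qw: "q w \<ge> 0" using q_nonneg wS by simp
    \<comment> \<open>a small negative step, for which the linear term outweighs the quadratic one\<close>
    define t where "t = - (w \<bullet> w) / (q w + 1)"
    have t: "t < 0" "t * q w > - 2 * (w \<bullet> w)"
      using ww qw by (auto simp: t_def field_simps intro!: add_nonneg_pos)
    have "2 * t * (w \<bullet> w) + t\<^sup>2 * q w = t * (2 * (w \<bullet> w) + t * q w)"
      by (simp add: power2_eq_square algebra_simps)
    also have "\<dots> < 0" using t by (simp add: mult_neg_pos)
    finally show False using quad[of t] by simp
  qed
  then have "A *v v = l *\<^sub>R v" by (simp add: w_def)
  then show thesis using that vS nv by blast
qed

text \<open>
  Induction on the dimension of an invariant subspace: split off a unit eigenvector \<open>v\<close>; by symmetry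
  its orthogonal complement within the subspace is again invariant, and it has smaller dimension.
\<close>

lemma symmetric_orthonormal_eigenbasis:
  fixes A :: "real^'n^'n"
  assumes sym: "transpose A = A" and "subspace S" "\<And>x. x \<in> S \<Longrightarrow> A *v x \<in> S"
  shows "\<exists>B. B \<subseteq> S \<and> pairwise orthogonal B \<and> (\<forall>b\<in>B. norm b = 1 \<and> (\<exists>l. A *v b = l *\<^sub>R b)) \<and> S \<subseteq> span B"
  using assms(2,3)
proof (induction "dim S" arbitrary: S rule: less_induct)
  case less
  show ?case
  proof (cases "S = {0}")
    case True
    then show ?thesis by (intro exI[of _ "{}"]) auto
  next
    case False
    obtain v l where v: "v \<in> S" "norm v = 1" "A *v v = l *\<^sub>R v"
      using symmetric_unit_eigenvector[OF sym less.prems(1) False less.prems(2)] .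
    define T where "T = S \<inter> {x. v \<bullet> x = 0}"
    have sT: "subspace T"
      unfolding T_def by (intro subspace_inter less.prems subspace_hyperplane)
    have "v \<notin> T" using v(2) by (auto simp: T_def norm_eq_1)
    then have "T \<subset> S" using v(1) unfolding T_def by blast
    then have "dim T < dim S"
      using dim_psubset[of T S] sT less.prems(1) by (metis span_eq_iff)
    moreover have "A *v x \<in> T" if "x \<in> T" for x
      using that less.prems(2) v(3) by (simp add: T_def symmetric_inner_swap[OF sym])
    ultimately obtain B where B: "B \<subseteq> T" "pairwise orthogonal B"
      "\<forall>b\<in>B. norm b = 1 \<and> (\<exists>l. A *v b = l *\<^sub>R b)" "T \<subseteq> span B"
      using less.hyps[of T] sT by blast
    have "S \<subseteq> span (insert v B)"
    proof
      fix x assume "x \<in> S"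
      then have "x - (v \<bullet> x) *\<^sub>R v \<in> T"
        using v less.prems(1) by (simp add: T_def subspace_diff subspace_scale inner_diff_right norm_eq_1)
      then show "x \<in> span (insert v B)"
        using B(4) by (auto simp: span_insert)
    qed
    moreover have "pairwise orthogonal (insert v B)"
      using B(1,2) by (auto simp: pairwise_insert orthogonal_def T_def inner_commute)
    ultimately show ?thesis
      using B v by (intro exI[of _ "insert v B"]) (auto simp: T_def)
  qed
qed

definition diag_matrix :: "('n \<Rightarrow> real) \<Rightarrow> real^'n^'n" where
  "diag_matrix d = (\<chi> i j. if i = j then d i else 0)"

lemma diag_matrix_mult: "diag_matrix d ** diag_matrix e = diag_matrix (\<lambda>i. d i * e i)"
  by (simp add: diag_matrix_def matrix_matrix_mult_def vec_eq_iff mult_delta_left)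

lemma transpose_diag_matrix [simp]: "transpose (diag_matrix d) = diag_matrix d"
  by (auto simp: diag_matrix_def transpose_def vec_eq_iff)

lemma trace_diag_matrix: "trace (diag_matrix d) = (\<Sum>i\<in>UNIV. d i)"
  by (simp add: diag_matrix_def trace_def)

lemma det_diag_matrix: "det (diag_matrix d) = (\<Prod>i\<in>UNIV. d i)"
  by (subst det_diagonal) (auto simp: diag_matrix_def)

lemma diag_matrix_quadratic: "x \<bullet> (diag_matrix d *v x) = (\<Sum>i\<in>UNIV. d i * (x $ i)\<^sup>2)"
  by (simp add: diag_matrix_def matrix_vector_mult_def inner_vec_def mult_delta_left
      power2_eq_square mult.left_commute)

lemma pos_def_diag_matrix: "pos_def (diag_matrix d) \<longleftrightarrow> (\<forall>i. d i > 0)"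
proof
  assume "pos_def (diag_matrix d)"
  then have "axis i 1 \<bullet> (diag_matrix d *v axis i (1::real)) > 0" for i
    by (simp add: pos_def_def axis_eq_0_iff)
  then show "\<forall>i. d i > 0"
    by (simp add: diag_matrix_quadratic axis_def power2_eq_square mult_delta_right)
next
  assume d: "\<forall>i. d i > 0"
  have "(\<Sum>i\<in>UNIV. d i * (x $ i)\<^sup>2) > 0" if "x \<noteq> 0" for x
  proof -
    obtain i where "x $ i \<noteq> 0" using \<open>x \<noteq> 0\<close> by (auto simp: vec_eq_iff)
    then show ?thesis
      using d by (intro sum_pos2[of UNIV i]) (auto simp: less_imp_le)
  qed
  then show "pos_def (diag_matrix d)" by (simp add: pos_def_def diag_matrix_quadratic)
qed

theorem spectral_theorem:
  fixes A :: "real^'n^'n"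
  assumes sym: "transpose A = A"
  obtains Q d where "orthogonal_matrix Q" "A = Q ** diag_matrix d ** transpose Q"
proof -
  obtain B where B: "pairwise orthogonal B" "\<forall>b\<in>B. norm b = 1 \<and> (\<exists>l. A *v b = l *\<^sub>R b)"
    "span B = (UNIV :: (real^'n) set)"
    using symmetric_orthonormal_eigenbasis[OF sym subspace_UNIV] by auto
  have "0 \<notin> B" using B(2) by auto
  then have ind: "independent B" using B(1) pairwise_orthogonal_independent by blast
  then have "card B = CARD('n)"
    using B(3) by (metis dim_span dim_UNIV dim_eq_card_independent DIM_cart DIM_real mult.right_neutral)
  moreover have "finite B" using ind by (rule independent_imp_finite)
  ultimately obtain f :: "'n \<Rightarrow> real^'n" where f: "bij_betw f UNIV B"
    using finite_same_card_bij[of "UNIV :: 'n set" B] by auto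
  have fB: "f i \<in> B" for i using f by (auto simp: bij_betw_def)
  then have "\<forall>i. \<exists>l. A *v f i = l *\<^sub>R f i" using B(2) by blast
  then obtain d where d: "\<And>i. A *v f i = d i *\<^sub>R f i" by metis
  \<comment> \<open>the matrix whose columns are the eigenvectors\<close>
  define Q :: "real^'n^'n" where "Q = (\<chi> i j. f j $ i)"
  have col: "column j Q = f j" for j by (simp add: Q_def column_def vec_eq_iff)
  have "f i \<noteq> f j" if "i \<noteq> j" for i j using f that by (auto simp: bij_betw_def inj_def)
  then have Q: "orthogonal_matrix Q"
    using B(1,2) fB unfolding orthogonal_matrix_orthonormal_columns col
    by (auto simp: pairwise_def)
  have "(A ** Q) $ i $ j = (Q ** diag_matrix d) $ i $ j" for i j
  proof -
    have "(A ** Q) $ i $ j = (A *v f j) $ i"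
      by (simp add: matrix_matrix_mult_def matrix_vector_mult_def Q_def)
    also have "\<dots> = (Q ** diag_matrix d) $ i $ j"
      by (simp add: d matrix_matrix_mult_def Q_def diag_matrix_def mult_delta_right mult.commute)
    finally show ?thesis .
  qed
  then have "A ** Q = Q ** diag_matrix d" by (simp add: vec_eq_iff)
  then have "A = Q ** diag_matrix d ** transpose Q"
    using Q by (metis matrix_mul_assoc matrix_mul_rid orthogonal_matrix_def)
  then show thesis using that Q by blast
qed

section \<open>Positive-definite matrices\<close>

lemma pos_def_transpose: "pos_def P \<Longrightarrow> transpose P = P"
  by (simp add: pos_def_def)

lemma pos_def_invertible:
  assumes "pos_def P" shows "invertible P"
proof -
  have "x = 0" if "P *v x = 0" for x
    using assms that unfolding pos_def_def by (metis inner_zero_right less_irrefl)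
  then show ?thesis
    unfolding invertible_left_inverse matrix_left_invertible_ker by blast
qed

lemma pos_def_congruence:
  fixes P S :: "real^'n^'n"
  assumes "pos_def P" "invertible S"
  shows "pos_def (transpose S ** P ** S)"
  unfolding pos_def_def
proof (intro conjI allI impI)
  show "transpose (transpose S ** P ** S) = transpose S ** P ** S"
    using assms(1) by (simp add: matrix_transpose_mul matrix_mul_assoc pos_def_def)
  fix x :: "real^'n" assume "x \<noteq> 0"
  then have "S *v x \<noteq> 0"
    using assms(2) unfolding invertible_left_inverse matrix_left_invertible_ker by blast
  then have "(S *v x) \<bullet> (P *v (S *v x)) > 0"
    using assms(1) by (simp add: pos_def_def)
  then show "x \<bullet> (transpose S ** P ** S *v x) > 0"
    by (simp add: inner_transpose_mult flip: matrix_vector_mul_assoc del: transpose_matrix_vector)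
qed

lemma pos_def_matrix_inv:
  fixes P :: "real^'n^'n"
  assumes "pos_def P" shows "pos_def (matrix_inv P)"
proof -
  have inv: "invertible P" using assms by (rule pos_def_invertible)
  have "transpose (matrix_inv P) ** P = transpose (P ** matrix_inv P)"
    using assms by (simp add: matrix_transpose_mul pos_def_def)
  then have 1: "transpose (matrix_inv P) ** P = mat 1" by (simp add: matrix_inv_right inv)
  then have sym: "transpose (matrix_inv P) = matrix_inv P"
    by (metis inv matrix_inv_right matrix_mul_assoc matrix_mul_lid matrix_mul_rid)
  have "invertible (matrix_inv P)"
    using inv matrix_inv_left matrix_inv_right unfolding invertible_def by blast
  from pos_def_congruence[OF assms this] show ?thesis by (simp add: sym matrix_inv_left inv)
qed

lemma pos_def_scaleR: "pos_def P \<Longrightarrow> c > 0 \<Longrightarrow> pos_def (c *\<^sub>R P)"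
  by (simp add: pos_def_def transpose_scalar flip: scaleR_matrix_vector_assoc)

lemma pos_def_add_nonneg:
  fixes P N :: "real^'n^'n"
  assumes "pos_def P" "transpose N = N" "\<And>x. x \<bullet> (N *v x) \<ge> 0"
  shows "pos_def (P + N)"
  unfolding pos_def_def
proof (intro conjI allI impI)
  show "transpose (P + N) = P + N" using assms by (simp add: transpose_add pos_def_def)
  fix x :: "real^'n" assume "x \<noteq> 0"
  then have "x \<bullet> (P *v x) > 0" using assms(1) by (simp add: pos_def_def)
  then show "x \<bullet> ((P + N) *v x) > 0"
    using assms(3)[of x] by (simp add: matrix_vector_mult_add_rdistrib inner_add_right)
qed

lemma pos_def_mat_1: "pos_def (mat 1)"
  by (simp add: pos_def_def)

lemma pos_def_inner_nonneg: "pos_def P \<Longrightarrow> x \<bullet> (P *v x) \<ge> 0"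
  by (cases "x = 0") (auto simp: pos_def_def less_imp_le)

lemma congruence_symmetric_nonneg:
  fixes N M :: "real^'n^'n"
  assumes "transpose N = N" "\<And>x. x \<bullet> (N *v x) \<ge> 0"
  shows "transpose (transpose M ** N ** M) = transpose M ** N ** M"
    and "x \<bullet> (transpose M ** N ** M *v x) \<ge> 0"
proof -
  show "transpose (transpose M ** N ** M) = transpose M ** N ** M"
    by (simp add: matrix_transpose_mul matrix_mul_assoc assms(1))
  have "x \<bullet> (transpose M ** N ** M *v x) = (M *v x) \<bullet> (N *v (M *v x))"
    by (simp add: inner_transpose_mult flip: matrix_vector_mul_assoc del: transpose_matrix_vector)
  then show "x \<bullet> (transpose M ** N ** M *v x) \<ge> 0" using assms(2) by simp
qed

lemma pos_def_spectral:
  fixes A :: "real^'n^'n"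
  assumes "pos_def A"
  obtains Q d where "orthogonal_matrix Q" "A = Q ** diag_matrix d ** transpose Q" "\<And>i. d i > 0"
proof -
  obtain Q d where Q: "orthogonal_matrix Q" and A: "A = Q ** diag_matrix d ** transpose Q"
    using spectral_theorem[OF pos_def_transpose[OF assms]] .
  have "transpose Q ** A ** Q = (transpose Q ** Q) ** diag_matrix d ** (transpose Q ** Q)"
    by (simp add: A matrix_mul_assoc)
  also have "\<dots> = diag_matrix d" using Q by (simp add: orthogonal_matrix_def)
  finally have "pos_def (diag_matrix d)"
    using pos_def_congruence[OF assms] Q by (metis invertible_def orthogonal_matrix_def)
  then show thesis using that Q A by (simp add: pos_def_diag_matrix)
qed


section \<open>Positive-definite square roots\<close>

text \<open>
  With \<open>D = S - T\<close> one has \<open>S D + D T = S\<^sup>2 - T\<^sup>2 = 0\<close>. Testing this against a unit eigenvector \<open>v\<close> of \<open>D\<close>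
  with eigenvalue \<open>l\<close> gives \<open>l (v \<bullet> S v + v \<bullet> T v) = 0\<close>, so \<open>l = 0\<close>. But if \<open>D \<noteq> 0\<close>, an eigenvector
  exists in the range of \<open>D\<close>, which is orthogonal to the kernel of \<open>D\<close>.
\<close>

lemma pos_def_square_inject:
  fixes S T :: "real^'n^'n"
  assumes S: "pos_def S" and T: "pos_def T" and eq: "S ** S = T ** T"
  shows "S = T"
proof (rule ccontr)
  define D where "D = S - T"
  assume "S \<noteq> T"
  then have "D \<noteq> 0" by (simp add: D_def)
  have symD: "transpose D = D"
    using S T by (simp add: D_def pos_def_def transpose_def vec_eq_iff)
  obtain u where u: "D *v u \<noteq> 0"
    using \<open>D \<noteq> 0\<close> by (metis matrix_eq matrix_vector_mult_0)
  have "subspace (range ((*v) D))"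
    by (intro linear_subspace_image matrix_vector_mul_linear subspace_UNIV)
  moreover have "range ((*v) D) \<noteq> {0}" using u by blast
  ultimately obtain v l where v: "v \<in> range ((*v) D)" "norm v = 1" "D *v v = l *\<^sub>R v"
    using symmetric_unit_eigenvector[OF symD] by blast
  have "v \<noteq> 0" using v(2) by auto
  have "S *v (D *v v) + D *v (T *v v) = (S ** S) *v v - (T ** T) *v v"
    by (simp add: D_def algebra_simps matrix_vector_mul_assoc[symmetric]
        matrix_vector_mult_diff_distrib matrix_vector_mult_diff_rdistrib)
  then have "v \<bullet> (S *v (D *v v)) + v \<bullet> (D *v (T *v v)) = 0"
    by (metis eq diff_self inner_add_right inner_zero_right)
  then have "l * (v \<bullet> (S *v v) + v \<bullet> (T *v v)) = 0"
    by (simp add: symmetric_inner_swap[OF symD, of v "T *v v"] v(3) matrix_vector_mult_scaleR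
        distrib_left)
  moreover have "v \<bullet> (S *v v) + v \<bullet> (T *v v) > 0"
    using S T \<open>v \<noteq> 0\<close> by (simp add: pos_def_def add_pos_pos)
  ultimately have "D *v v = 0" using v(3) by simp
  moreover obtain w where "v = D *v w" using v(1) by blast
  ultimately have "v \<bullet> v = 0"
    by (metis symD symmetric_inner_swap inner_zero_left)
  then show False using \<open>v \<noteq> 0\<close> by simp
qed

lemma pd_sqrt_eqI: "pos_def S \<Longrightarrow> S ** S = P \<Longrightarrow> pd_sqrt P = S"
  unfolding pd_sqrt_def by (intro the_equality) (auto intro: pos_def_square_inject)

lemma pd_sqrt:
  assumes "pos_def P"
  shows "pos_def (pd_sqrt P)" and "pd_sqrt P ** pd_sqrt P = P"
proof -
  obtain Q d where Q: "orthogonal_matrix Q" and P: "P = Q ** diag_matrix d ** transpose Q"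
    and d: "\<And>i. d i > 0" using pos_def_spectral[OF assms] by blast
  define S where "S = Q ** diag_matrix (\<lambda>i. sqrt (d i)) ** transpose Q"
  have QQ: "Q ** transpose Q = mat 1" "transpose Q ** Q = mat 1"
    using Q by (simp_all add: orthogonal_matrix_def)
  have "pos_def (transpose (transpose Q) ** diag_matrix (\<lambda>i. sqrt (d i)) ** transpose Q)"
    using QQ d by (intro pos_def_congruence) (auto simp: pos_def_diag_matrix invertible_def)
  then have S: "pos_def S" by (simp add: S_def)
  have "S ** S = Q ** diag_matrix (\<lambda>i. sqrt (d i)) ** (transpose Q ** Q)
      ** diag_matrix (\<lambda>i. sqrt (d i)) ** transpose Q"
    by (simp add: S_def matrix_mul_assoc)
  also have "\<dots> = Q ** (diag_matrix (\<lambda>i. sqrt (d i)) ** diag_matrix (\<lambda>i. sqrt (d i))) ** transpose Q"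
    by (simp only: QQ matrix_mul_rid matrix_mul_assoc)
  also have "\<dots> = P" using d by (simp add: diag_matrix_mult P less_imp_le)
  finally have "S ** S = P" .
  with S show "pos_def (pd_sqrt P)" "pd_sqrt P ** pd_sqrt P = P"
    using pd_sqrt_eqI[OF S] by auto
qed

lemma pd_sqrt_invertible_symmetric:
  fixes P :: "real^'n^'n"
  assumes "pos_def P"
  shows "pos_def (pd_sqrt P)" "invertible (pd_sqrt P)" "transpose (pd_sqrt P) = pd_sqrt P"
    "matrix_inv (pd_sqrt P) ** matrix_inv (pd_sqrt P) = matrix_inv P"
proof -
  define a where "a = pd_sqrt P"
  have a: "pos_def a" "a ** a = P" using pd_sqrt[OF assms] by (simp_all add: a_def)
  show "pos_def (pd_sqrt P)" "transpose (pd_sqrt P) = pd_sqrt P" "invertible (pd_sqrt P)"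
    using a pos_def_invertible pos_def_transpose by (auto simp: a_def)
  have i: "invertible a" using a pos_def_invertible by blast
  have "P ** (matrix_inv a ** matrix_inv a) = mat 1"
    by (simp add: a(2)[symmetric] matrix_mul_assoc[symmetric] matrix_inv_cancel_left matrix_inv_right i)
  then show "matrix_inv (pd_sqrt P) ** matrix_inv (pd_sqrt P) = matrix_inv P"
    using matrix_inv_eqI a_def by metis
qed

section \<open>Determinant, trace and the strict concavity of \<open>log det\<close>\<close>

lemma pos_def_det_pos: "pos_def A \<Longrightarrow> det A > 0"
proof -
  assume "pos_def A"
  then obtain Q d where Q: "orthogonal_matrix Q" and A: "A = Q ** diag_matrix d ** transpose Q"
    and d: "\<And>i. d i > 0" using pos_def_spectral by blast
  have "det (Q ** transpose Q) = 1" using Q by (simp add: orthogonal_matrix_def)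
  then have "det A = det (diag_matrix d)"
    by (simp add: A det_mul mult.commute mult.left_commute)
  then show "det A > 0" using d by (simp add: det_diag_matrix prod_pos)
qed

text \<open>
  Summing \<open>ln x \<le> x - 1\<close> over the eigenvalues; equality would force all eigenvalues to be \<open>1\<close>.
\<close>

lemma ln_det_less_trace:
  fixes W :: "real^'n^'n"
  assumes "pos_def W" "W \<noteq> mat 1"
  shows "ln (det W) < trace W - CARD('n)"
proof -
  obtain Q d where Q: "orthogonal_matrix Q" and W: "W = Q ** diag_matrix d ** transpose Q"
    and d: "\<And>i. d i > 0" using pos_def_spectral[OF assms(1)] by blast
  have QQ: "Q ** transpose Q = mat 1" "transpose Q ** Q = mat 1"
    using Q by (simp_all add: orthogonal_matrix_def)
  have "det (Q ** transpose Q) = 1" by (simp add: QQ)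
  then have det: "det W = (\<Prod>i\<in>UNIV. d i)"
    by (simp add: W det_mul det_diag_matrix mult.commute mult.left_commute)
  have "trace W = trace (transpose Q ** (Q ** diag_matrix d))"
    unfolding W by (rule trace_mul_sym)
  then have tr: "trace W = (\<Sum>i\<in>UNIV. d i)"
    by (simp add: matrix_mul_assoc QQ trace_diag_matrix)
  have "\<exists>i. d i \<noteq> 1"
  proof (rule ccontr)
    assume "\<not> ?thesis"
    then have "diag_matrix d = mat 1" by (simp add: diag_matrix_def mat_def vec_eq_iff)
    then show False using assms(2) by (simp add: W QQ)
  qed
  then obtain k where "d k \<noteq> 1" ..
  then have "ln (d k) < d k - 1"
    using d[of k] ln_le_minus_one[of "d k"] ln_eq_minus_one[of "d k"] by fastforce
  then have "(\<Sum>i\<in>UNIV. ln (d i)) < (\<Sum>i\<in>UNIV. d i - 1)"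
    using d by (intro sum_strict_mono_ex1) (auto intro: ln_le_minus_one)
  moreover have "ln (det W) = (\<Sum>i\<in>UNIV. ln (d i))"
    unfolding det using d by (intro ln_prod) (simp_all add: order_less_imp_not_eq2)
  ultimately show ?thesis by (simp add: tr sum_subtractf)
qed

text \<open>
  The graph of \<open>log det\<close> lies strictly below its tangent plane at \<open>Y\<close>. Conjugating by
  \<open>s = Y\<^sup>-\<^sup>1\<^sup>/\<^sup>2\<close> moves \<open>Y\<close> to the identity and reduces the claim to \<open>ln_det_less_trace\<close> for \<open>W = s X s\<close>.
\<close>

lemma ln_det_less_tangent:
  fixes X Y :: "real^'n^'n"
  assumes X: "pos_def X" and Y: "pos_def Y" and "X \<noteq> Y"
  shows "ln (det X) < ln (det Y) + trace (matrix_inv Y ** (X - Y))"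
proof -
  define s where "s = pd_sqrt (matrix_inv Y)"
  have invY: "invertible Y" using Y by (rule pos_def_invertible)
  have s: "pos_def s" "s ** s = matrix_inv Y"
    using pd_sqrt[OF pos_def_matrix_inv[OF Y]] by (simp_all add: s_def)
  have invs: "invertible s" using s(1) by (rule pos_def_invertible)
  define W where "W = s ** X ** s"
  have W: "pos_def W"
    using pos_def_congruence[OF X invs] pos_def_transpose[OF s(1)] by (simp add: W_def)
  have "W \<noteq> mat 1"
  proof
    assume "W = mat 1"
    have "s ** (s ** X) = s ** W ** matrix_inv s"
      by (simp add: W_def matrix_mul_assoc[symmetric] matrix_inv_right invs)
    also have "\<dots> = mat 1" by (simp add: \<open>W = mat 1\<close> matrix_inv_right invs)
    finally have "Y ** (matrix_inv Y ** X) = Y" by (simp add: s(2)[symmetric] matrix_mul_assoc[symmetric])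
    then show False using \<open>X \<noteq> Y\<close> by (simp add: matrix_inv_cancel_left invY)
  qed
  with W have "ln (det W) < trace W - CARD('n)" by (rule ln_det_less_trace)
  moreover have "ln (det W) = ln (det X) - ln (det Y)"
  proof -
    have "det Y * (det s * det s) = 1"
      by (metis s(2) det_I det_mul invY matrix_inv_right)
    then have "det W = det X / det Y"
      using pos_def_det_pos[OF Y] by (simp add: W_def det_mul field_simps)
    then show ?thesis using pos_def_det_pos[OF X] pos_def_det_pos[OF Y] by (simp add: ln_divide_pos)
  qed
  moreover have "trace W - CARD('n) = trace (matrix_inv Y ** (X - Y))"
  proof -
    have "trace W = trace (s ** (s ** X))"
      unfolding W_def by (rule trace_mul_sym)
    then have "trace W = trace (matrix_inv Y ** X)" by (simp add: matrix_mul_assoc s(2))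
    moreover have "matrix_inv Y ** (X - Y) + matrix_inv Y ** Y = matrix_inv Y ** X"
      by (simp flip: matrix_add_ldistrib)
    then have "trace (matrix_inv Y ** (X - Y)) + CARD('n) = trace (matrix_inv Y ** X)"
      by (metis invY matrix_inv_left trace_I trace_add)
    ultimately show ?thesis by simp
  qed
  ultimately show ?thesis by simp
qed

section \<open>Block matrices\<close>

lemma sum_UNIV_Plus:
  fixes f :: "'a::finite + 'b::finite \<Rightarrow> 'c::comm_monoid_add"
  shows "(\<Sum>i\<in>UNIV. f i) = (\<Sum>i\<in>UNIV. f (Inl i)) + (\<Sum>i\<in>UNIV. f (Inr i))"
  using sum.Plus[of UNIV UNIV f] by (simp add: o_def)

lemma block_matrix_eq_iff:
  "block_matrix P Q R S = block_matrix P' Q' R' S' \<longleftrightarrow> P = P' \<and> Q = Q' \<and> R = R' \<and> S = S'"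
  by (auto simp: block_matrix_def vec_eq_iff split_sum_all)

lemma block_matrix_mult:
  "block_matrix P Q R S ** block_matrix P' Q' R' S' =
     block_matrix (P ** P' + Q ** R') (P ** Q' + Q ** S') (R ** P' + S ** R') (R ** Q' + S ** S')"
  by (simp add: block_matrix_def matrix_matrix_mult_def vec_eq_iff split_sum_all sum_UNIV_Plus)

lemma block_matrix_diff:
  "block_matrix P Q R S - block_matrix P' Q' R' S' = block_matrix (P - P') (Q - Q') (R - R') (S - S')"
  by (simp add: block_matrix_def vec_eq_iff split_sum_all)

lemma trace_block_matrix: "trace (block_matrix P Q R S) = trace P + trace S"
  by (simp add: block_matrix_def trace_def sum_UNIV_Plus)

lemma transpose_block_matrix:
  "transpose (block_matrix P Q R S) = block_matrix (transpose P) (transpose R) (transpose Q) (transpose S)"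
  by (simp add: block_matrix_def transpose_def vec_eq_iff split_sum_all)

lemma block_matrix_quadratic:
  fixes P Q R S :: "real^'n^'n" and z :: "real^('n + 'n)"
  defines "x \<equiv> (\<chi> i. z $ Inl i)" and "y \<equiv> (\<chi> i. z $ Inr i)"
  shows "z \<bullet> (block_matrix P Q R S *v z) = x \<bullet> (P *v x) + x \<bullet> (Q *v y) + y \<bullet> (R *v x) + y \<bullet> (S *v y)"
  by (simp add: x_def y_def block_matrix_def matrix_vector_mult_def inner_vec_def sum_UNIV_Plus
      distrib_left sum.distrib)

text \<open>
  Completing the square: with \<open>z = (x, y)\<close> and \<open>w = x - F\<^sup>-\<^sup>1 M y\<close>, the quadratic form is
  \<open>w \<bullet> F w + y \<bullet> S y\<close>, where \<open>S = G - M\<^sup>T F\<^sup>-\<^sup>1 M\<close> is the Schur complement.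
\<close>

lemma pos_def_block_matrix_Schur:
  fixes F G M :: "real^'n^'n"
  assumes F: "pos_def F" and S: "pos_def (G - transpose M ** matrix_inv F ** M)"
  shows "pos_def (block_matrix F (- M) (- transpose M) G)"
  unfolding pos_def_def
proof (intro conjI allI impI)
  define N where "N = matrix_inv F"
  have N: "pos_def N" unfolding N_def using F by (rule pos_def_matrix_inv)
  have invF: "invertible F" using F by (rule pos_def_invertible)
  have symC: "transpose (transpose M ** N ** M) = transpose M ** N ** M"
    using N by (intro congruence_symmetric_nonneg) (auto simp: pos_def_inner_nonneg pos_def_transpose)
  have "transpose ((G - transpose M ** N ** M) + transpose M ** N ** M)
      = (G - transpose M ** N ** M) + transpose M ** N ** M"
    unfolding transpose_add symC using pos_def_transpose[OF S] by (simp add: N_def)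
  then have symG: "transpose G = G" by simp
  show "transpose (block_matrix F (- M) (- transpose M) G) = block_matrix F (- M) (- transpose M) G"
    by (simp add: transpose_block_matrix transpose_uminus symG pos_def_transpose[OF F])
  fix z :: "real^('n + 'n)" assume "z \<noteq> 0"
  define x y where "x = (\<chi> i. z $ Inl i)" and "y = (\<chi> i. z $ Inr i)"
  have xy: "x \<noteq> 0 \<or> y \<noteq> 0" using \<open>z \<noteq> 0\<close> by (auto simp: x_def y_def vec_eq_iff split_sum_all)
  define w where "w = x - N *v (M *v y)"
  have FN: "F *v (N *v u) = u" for u
    by (simp add: N_def matrix_vector_mul_assoc matrix_inv_right invF)
  have "z \<bullet> (block_matrix F (- M) (- transpose M) G *v z) =
      x \<bullet> (F *v x) - 2 * (x \<bullet> (M *v y)) + y \<bullet> (G *v y)"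
    by (simp add: block_matrix_quadratic x_def y_def matrix_vector_mult_uminus inner_transpose_mult
        inner_commute del: transpose_matrix_vector)
  also have "\<dots> = w \<bullet> (F *v w) + y \<bullet> ((G - transpose M ** N ** M) *v y)"
  proof -
    define m where "m = M *v y"
    have "w \<bullet> (F *v w) = x \<bullet> (F *v x) - 2 * (x \<bullet> m) + m \<bullet> (N *v m)"
    proof -
      have "w \<bullet> (F *v w) = (x - N *v m) \<bullet> (F *v x - m)"
        by (simp add: w_def m_def matrix_vector_mult_diff_distrib FN)
      moreover have "(N *v m) \<bullet> (F *v x) = m \<bullet> x"
        by (simp add: symmetric_inner_swap[OF pos_def_transpose[OF F]] FN)
      ultimately show ?thesis
        by (simp add: inner_diff_left inner_diff_right inner_commute)
    qed
    moreover have "y \<bullet> ((transpose M ** N ** M) *v y) = m \<bullet> (N *v m)"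
      by (simp add: m_def inner_transpose_mult flip: matrix_vector_mul_assoc del: transpose_matrix_vector)
    ultimately show ?thesis
      by (simp add: m_def matrix_vector_mult_diff_rdistrib inner_diff_right)
  qed
  also have "\<dots> > 0"
  proof (cases "y = 0")
    case True
    then have "w \<noteq> 0" using xy by (simp add: w_def)
    then show ?thesis using True F by (simp add: pos_def_def)
  next
    case False
    then show ?thesis using S pos_def_inner_nonneg[OF F, of w] by (simp add: pos_def_def N_def add_nonneg_pos)
  qed
  finally show "z \<bullet> (block_matrix F (- M) (- transpose M) G *v z) > 0" .
qed


section \<open>The matrix Riccati equation\<close>

text \<open>
  With \<open>a = P\<^sup>1\<^sup>/\<^sup>2\<close> and \<open>R = (a C a + \<epsilon>\<^sup>2/4)\<^sup>1\<^sup>/\<^sup>2\<close> the matrix \<open>F\<close> is \<open>a\<^sup>-\<^sup>1 (\<epsilon>/2 + R) a\<^sup>-\<^sup>1\<close>, manifestly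
  symmetric, and the Riccati equation is the conjugate of \<open>(\<epsilon>/2 + R)\<^sup>2 = \<epsilon> (\<epsilon>/2 + R) + a C a\<close>.
\<close>

lemma Riccati_solution:
  fixes P C F :: "real^'n^'n"
  assumes P: "pos_def P" and C: "transpose C = C" "\<And>x. x \<bullet> (C *v x) \<ge> 0" and e: "\<epsilon> > 0"
    and F: "F = matrix_inv P ** ((\<epsilon> / 2) *\<^sub>R mat 1 + prod_shift_sqrt P C (\<epsilon>\<^sup>2 / 4))"
  shows "pos_def F" and "F ** P ** F = \<epsilon> *\<^sub>R F + C"
proof -
  define a b where "a = pd_sqrt P" and "b = matrix_inv a"
  have a: "pos_def a" "invertible a" "transpose a = a" "b ** b = matrix_inv P" "a ** a = P"
    using pd_sqrt_invertible_symmetric[OF P] pd_sqrt(2)[OF P] by (simp_all add: a_def b_def)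
  have b: "pos_def b" using a(1) pos_def_matrix_inv b_def by blast
  have ab: "a ** b = mat 1" "b ** a = mat 1" "a ** (b ** X) = X" "b ** (a ** X) = X" for X
    using a(2) by (simp_all add: b_def matrix_inv_left matrix_inv_right matrix_inv_cancel_left)
  define R where "R = pd_sqrt (a ** C ** a + (\<epsilon>\<^sup>2 / 4) *\<^sub>R mat 1)"
  have "pos_def ((\<epsilon>\<^sup>2 / 4) *\<^sub>R mat 1 + transpose a ** C ** a)"
    using e C by (intro pos_def_add_nonneg pos_def_scaleR pos_def_mat_1
        congruence_symmetric_nonneg) auto
  then have R: "pos_def R" "R ** R = a ** C ** a + (\<epsilon>\<^sup>2 / 4) *\<^sub>R mat 1"
    using pd_sqrt[of "a ** C ** a + (\<epsilon>\<^sup>2 / 4) *\<^sub>R mat 1"]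
    unfolding R_def a(3) by (simp_all add: add.commute)
  have Fb: "F = b ** ((\<epsilon> / 2) *\<^sub>R mat 1 + R) ** b"
    unfolding F prod_shift_sqrt_def a_def[symmetric] b_def[symmetric] R_def[symmetric]
    by (simp add: a(4)[symmetric] mat_distribs matrix_mul_assoc[symmetric] ab)
  have "pos_def ((\<epsilon> / 2) *\<^sub>R mat 1 + R)"
    using e R(1) by (intro pos_def_add_nonneg pos_def_scaleR pos_def_mat_1)
      (auto simp: pos_def_inner_nonneg pos_def_transpose)
  from pos_def_congruence[OF this pos_def_invertible[OF b]]
  show "pos_def F" by (simp add: Fb pos_def_transpose[OF b])
  have "F ** P ** F = b ** (((\<epsilon> / 2) *\<^sub>R mat 1 + R) ** ((\<epsilon> / 2) *\<^sub>R mat 1 + R)) ** b"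
    by (simp add: Fb a(5)[symmetric] matrix_mul_assoc[symmetric] ab)
  also have "((\<epsilon> / 2) *\<^sub>R mat 1 + R) ** ((\<epsilon> / 2) *\<^sub>R mat 1 + R)
      = \<epsilon> *\<^sub>R ((\<epsilon> / 2) *\<^sub>R mat 1 + R) + a ** C ** a"
  proof -
    have "((\<epsilon> / 2) *\<^sub>R mat 1 + R) ** ((\<epsilon> / 2) *\<^sub>R mat 1 + R)
      = (\<epsilon> / 2) *\<^sub>R ((\<epsilon> / 2) *\<^sub>R mat 1 + R) + ((\<epsilon> / 2) *\<^sub>R R + R ** R)"
      by (simp add: mat_distribs)
    then show ?thesis
      by (simp add: R(2) vec_eq_iff power2_eq_square field_simps)
  qed
  also have "b ** \<dots> ** b = \<epsilon> *\<^sub>R F + C"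
    by (simp add: Fb mat_distribs scaleR_add_right matrix_mul_assoc[symmetric] ab)
  finally show "F ** P ** F = \<epsilon> *\<^sub>R F + C" .
qed

text \<open>
  Positivity of \<open>G - \<epsilon>/2 P\<^sup>-\<^sup>1\<close> selects the branch of the square root: it makes
  \<open>R = P\<^sup>1\<^sup>/\<^sup>2 G P\<^sup>1\<^sup>/\<^sup>2 - \<epsilon>/2\<close> positive-definite, and the Riccati equation says that
  \<open>R\<^sup>2 = P\<^sup>1\<^sup>/\<^sup>2 C P\<^sup>1\<^sup>/\<^sup>2 + \<epsilon>\<^sup>2/4\<close>.
\<close>

lemma Riccati_solution_unique:
  fixes P C G :: "real^'n^'n"
  assumes P: "pos_def P" and pos: "pos_def (G - (\<epsilon> / 2) *\<^sub>R matrix_inv P)"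
    and eq: "G ** P ** G = \<epsilon> *\<^sub>R G + C"
  shows "G = matrix_inv P ** ((\<epsilon> / 2) *\<^sub>R mat 1 + prod_shift_sqrt P C (\<epsilon>\<^sup>2 / 4))"
proof -
  define a b where "a = pd_sqrt P" and "b = matrix_inv a"
  have a: "pos_def a" "invertible a" "transpose a = a" "b ** b = matrix_inv P" "a ** a = P"
    using pd_sqrt_invertible_symmetric[OF P] pd_sqrt(2)[OF P] by (simp_all add: a_def b_def)
  have ab: "a ** b = mat 1" "b ** a = mat 1" "a ** (b ** X) = X" "b ** (a ** X) = X" for X
    using a(2) by (simp_all add: b_def matrix_inv_left matrix_inv_right matrix_inv_cancel_left)
  define H where "H = G - (\<epsilon> / 2) *\<^sub>R matrix_inv P"
  define R where "R = a ** H ** a"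
  have G: "G = (\<epsilon> / 2) *\<^sub>R (b ** b) + H" by (simp add: H_def a(4))
  have "pos_def R"
    using pos_def_congruence[OF pos a(2)] by (simp add: R_def H_def a(3))
  moreover have "R ** R = a ** C ** a + (\<epsilon>\<^sup>2 / 4) *\<^sub>R mat 1"
  proof -
    have "a ** (G ** P ** G) ** a = (\<epsilon> / 2) *\<^sub>R ((\<epsilon> / 2) *\<^sub>R mat 1 + R) + ((\<epsilon> / 2) *\<^sub>R R + R ** R)"
      by (simp only: G R_def a(5)[symmetric] mat_distribs matrix_mul_assoc[symmetric] ab
          matrix_mul_lid matrix_mul_rid scaleR_add_right ac_simps)
    moreover have "a ** (\<epsilon> *\<^sub>R G + C) ** a = \<epsilon> *\<^sub>R ((\<epsilon> / 2) *\<^sub>R mat 1 + R) + a ** C ** a"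
      by (simp add: G R_def mat_distribs matrix_mul_assoc[symmetric] ab scaleR_add_right)
    ultimately have "R ** R = \<epsilon> *\<^sub>R ((\<epsilon> / 2) *\<^sub>R mat 1 + R) + a ** C ** a
        - ((\<epsilon> / 2) *\<^sub>R ((\<epsilon> / 2) *\<^sub>R mat 1 + R) + (\<epsilon> / 2) *\<^sub>R R)"
      using eq by (simp add: eq_diff_eq ac_simps)
    also have "\<dots> = a ** C ** a + (\<epsilon>\<^sup>2 / 4) *\<^sub>R mat 1"
      by (simp add: vec_eq_iff power2_eq_square field_simps)
    finally show ?thesis .
  qed
  ultimately have "pd_sqrt (a ** C ** a + (\<epsilon>\<^sup>2 / 4) *\<^sub>R mat 1) = R" by (rule pd_sqrt_eqI)
  then show ?thesis
    unfolding prod_shift_sqrt_def a_def[symmetric] b_def[symmetric]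
    by (simp add: G R_def a(4)[symmetric] mat_distribs matrix_mul_assoc[symmetric] ab)
qed

text \<open>
  Write \<open>C = M\<^sup>T F\<^sup>-\<^sup>1 M\<close>. Multiplying the equation for \<open>F\<close> by \<open>M\<^sup>T F\<^sup>-\<^sup>1\<close> and \<open>F\<^sup>-\<^sup>1 M\<close> gives
  \<open>M\<^sup>T A M = \<epsilon> C + C B C\<close>, which is exactly what makes \<open>G = \<epsilon> B\<^sup>-\<^sup>1 + C\<close> a solution of
  \<open>G B G = \<epsilon> G + M\<^sup>T A M\<close>; and \<open>G - \<epsilon>/2 B\<^sup>-\<^sup>1 = \<epsilon>/2 B\<^sup>-\<^sup>1 + C\<close> is positive-definite because \<open>C\<close> is
  positive-semidefinite.
\<close>

lemma Riccati_dual_solution: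
  fixes A B M F :: "real^'n^'n"
  assumes B: "pos_def B" and F: "pos_def F" and e: "\<epsilon> > 0"
    and eq: "F ** A ** F = \<epsilon> *\<^sub>R F + M ** B ** transpose M"
  shows "\<epsilon> *\<^sub>R matrix_inv B + transpose M ** matrix_inv F ** M
    = matrix_inv B ** ((\<epsilon> / 2) *\<^sub>R mat 1 + prod_shift_sqrt B (transpose M ** A ** M) (\<epsilon>\<^sup>2 / 4))"
proof (rule Riccati_solution_unique[OF B])
  define N C where "N = matrix_inv F" and "C = transpose M ** N ** M"
  have inv: "invertible F" "invertible B" using F B pos_def_invertible by blast+
  have N: "pos_def N" unfolding N_def using F by (rule pos_def_matrix_inv)
  have "pos_def ((\<epsilon> / 2) *\<^sub>R matrix_inv B + C)"
    using e B N unfolding C_def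
    by (intro pos_def_add_nonneg pos_def_scaleR pos_def_matrix_inv congruence_symmetric_nonneg)
      (auto simp: pos_def_inner_nonneg pos_def_transpose)
  moreover have "\<epsilon> *\<^sub>R matrix_inv B + C - (\<epsilon> / 2) *\<^sub>R matrix_inv B = (\<epsilon> / 2) *\<^sub>R matrix_inv B + C"
    by (simp add: vec_eq_iff field_simps)
  ultimately show "pos_def (\<epsilon> *\<^sub>R matrix_inv B + transpose M ** matrix_inv F ** M
      - (\<epsilon> / 2) *\<^sub>R matrix_inv B)"
    by (simp only: C_def N_def)
  have "N ** (F ** A ** F) ** N = \<epsilon> *\<^sub>R N + N ** (M ** B ** transpose M) ** N"
    unfolding eq N_def by (simp add: mat_distribs matrix_inv_left matrix_inv_cancel_left inv)
  moreover have "N ** (F ** A ** F) ** N = A"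
    by (simp add: N_def matrix_mul_assoc[symmetric] matrix_inv_right matrix_inv_cancel_left inv)
  ultimately have "transpose M ** A ** M =
      transpose M ** (\<epsilon> *\<^sub>R N + N ** (M ** B ** transpose M) ** N) ** M"
    by simp
  then have MAM: "transpose M ** A ** M = \<epsilon> *\<^sub>R C + C ** B ** C"
    by (simp add: C_def mat_distribs matrix_mul_assoc[symmetric])
  show "(\<epsilon> *\<^sub>R matrix_inv B + transpose M ** matrix_inv F ** M) ** B **
      (\<epsilon> *\<^sub>R matrix_inv B + transpose M ** matrix_inv F ** M)
    = \<epsilon> *\<^sub>R (\<epsilon> *\<^sub>R matrix_inv B + transpose M ** matrix_inv F ** M) + transpose M ** A ** M"
    unfolding N_def[symmetric] C_def[symmetric] MAM
    by (simp only: mat_distribs matrix_mul_assoc[symmetric] matrix_inv_left matrix_inv_right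
        matrix_inv_cancel_left inv matrix_mul_lid matrix_mul_rid scaleR_add_right ac_simps)
qed

section \<open>Optimality in the dual problem\<close>

text \<open>
  The off-diagonal blocks of the inverse are \<open>F\<^sup>-\<^sup>1 M B / \<epsilon>\<close> and its transpose, but only the diagonal
  blocks matter below, because competing block matrices differ in their diagonal blocks only.
\<close>

lemma matrix_inv_block_critical:
  fixes A B M F G :: "real^'n^'n"
  assumes B: "pos_def B" and F: "pos_def F" and e: "\<epsilon> > 0"
    and eq: "F ** A ** F = \<epsilon> *\<^sub>R F + M ** B ** transpose M"
    and G: "G = \<epsilon> *\<^sub>R matrix_inv B + transpose M ** matrix_inv F ** M"
  shows "\<exists>U V. matrix_inv (block_matrix F (- M) (- transpose M) G) = (1 / \<epsilon>) *\<^sub>R block_matrix A U V B"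
proof -
  define N where "N = matrix_inv F"
  have inv: "invertible F" "invertible B" using F B pos_def_invertible by blast+
  have FN: "F ** N = mat 1" "F ** (N ** X) = X" for X
    using inv by (simp_all add: N_def matrix_inv_right matrix_inv_cancel_left)
  define U V where "U = N ** M ** B" and "V = B ** transpose M ** N"
  have "F ** A ** (F ** N) = (\<epsilon> *\<^sub>R F + M ** B ** transpose M) ** N"
    unfolding matrix_mul_assoc eq ..
  then have FA: "F ** A = \<epsilon> *\<^sub>R mat 1 + M ** V"
    by (simp add: FN mat_distribs V_def matrix_mul_assoc)
  have "N ** (F ** A) = N ** (\<epsilon> *\<^sub>R mat 1 + M ** V)" by (simp only: FA)
  then have A: "A = \<epsilon> *\<^sub>R N + N ** M ** V"
    by (simp add: N_def matrix_inv_cancel_left inv mat_distribs matrix_mul_assoc[symmetric])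
  have GV: "G ** V = transpose M ** A"
    by (simp add: A G V_def N_def[symmetric] mat_distribs matrix_mul_assoc[symmetric]
        matrix_inv_cancel_left inv)
  have GB: "G ** B = \<epsilon> *\<^sub>R mat 1 + transpose M ** U"
    by (simp add: G U_def N_def[symmetric] mat_distribs matrix_mul_assoc[symmetric] matrix_inv_left inv)
  have FU: "F ** U = M ** B" by (simp add: U_def FN matrix_mul_assoc[symmetric])
  have "block_matrix F (- M) (- transpose M) G ** block_matrix A U V B
      = block_matrix (\<epsilon> *\<^sub>R mat 1) 0 0 (\<epsilon> *\<^sub>R mat 1)"
    by (simp add: block_matrix_mult block_matrix_eq_iff matrix_mul_uminus FA FU GV GB)
  also have "\<dots> = \<epsilon> *\<^sub>R mat 1"
    by (simp add: block_matrix_def mat_def vec_eq_iff split_sum_all)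
  finally have "block_matrix F (- M) (- transpose M) G ** ((1 / \<epsilon>) *\<^sub>R block_matrix A U V B) = mat 1"
    using e by (simp add: mat_distribs)
  then show ?thesis using matrix_inv_eqI by blast
qed

text \<open>
  The tangent-plane inequality at the critical point. The difference of the two block matrices is
  block-diagonal, so \<open>\<epsilon> tr (Y\<^sup>-\<^sup>1 (X - Y)) = tr (A (F - F0)) + tr (B (G - G0))\<close>, which cancels the change of
  the linear part of the objective. Where the block matrix is not positive-definite, the objective
  is \<open>-\<infinity>\<close>.
\<close>

lemma dual_objective_less_critical:
  fixes A B M F G F0 G0 :: "real^'n^'n"
  assumes AB: "pos_def A" "pos_def B" and e: "\<epsilon> > 0"
    and Y: "pos_def (block_matrix F0 (- M) (- transpose M) G0)"
    and inv: "matrix_inv (block_matrix F0 (- M) (- transpose M) G0) = (1 / \<epsilon>) *\<^sub>R block_matrix A U V B"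
    and ne: "(F, G) \<noteq> (F0, G0)"
  shows "dual_objective A B M \<epsilon> (F, G) < dual_objective A B M \<epsilon> (F0, G0)"
proof (cases "pos_def (block_matrix F (- M) (- transpose M) G)")
  case False
  then show ?thesis using Y e by (simp add: dual_objective_def log_det_def)
next
  case True
  let ?X = "block_matrix F (- M) (- transpose M) G"
  let ?Y = "block_matrix F0 (- M) (- transpose M) G0"
  have hs: "hs_inner (mat 1 - K) P = trace P - trace (K ** P)" if "pos_def P" for K P :: "real^'n^'n"
  proof -
    have "(mat 1 - K) ** P + K ** P = P" by (simp flip: matrix_add_rdistrib)
    then show ?thesis
      using that by (metis add_diff_cancel_right' hs_inner_def pos_def_transpose trace_add)
  qed
  have tr: "trace (P ** (K - L)) = trace (K ** P) - trace (L ** P)" for K L P :: "real^'n^'n"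
  proof -
    have "P ** (K - L) + P ** L = P ** K" by (simp flip: matrix_add_ldistrib)
    then show ?thesis by (metis add_diff_cancel_right' trace_add trace_mul_sym)
  qed
  have trs: "trace (c *\<^sub>R P) = c * trace P" for c and P :: "real^('n + 'n)^('n + 'n)"
    by (simp add: trace_def sum_distrib_left)
  have "?X \<noteq> ?Y" using ne by (simp add: block_matrix_eq_iff)
  with True Y have "ln (det ?X) < ln (det ?Y) + trace (matrix_inv ?Y ** (?X - ?Y))"
    by (rule ln_det_less_tangent)
  also have "trace (matrix_inv ?Y ** (?X - ?Y)) =
      (1 / \<epsilon>) * (trace (A ** (F - F0)) + trace (B ** (G - G0)))"
    by (simp add: inv block_matrix_diff scalar_matrix_assoc[symmetric] block_matrix_mult trs
        trace_block_matrix)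
  finally have "\<epsilon> * ln (det ?X) < \<epsilon> * (ln (det ?Y) + (1 / \<epsilon>) * (trace (A ** (F - F0)) + trace (B ** (G - G0))))"
    using e by (rule mult_strict_left_mono)
  then have "\<epsilon> * ln (det ?X) < \<epsilon> * ln (det ?Y) + trace (A ** (F - F0)) + trace (B ** (G - G0))"
    using e by (simp add: distrib_left)
  then show ?thesis
    using True Y AB by (simp add: dual_objective_def log_det_def hs tr)
qed

theorem theorem3p2:
  fixes A B M F_opt G_opt :: "real^'n^'n"
    and \<Sigma> :: "real^('n + 'n)^('n + 'n)"
    and \<epsilon> :: real
  assumes "pos_def A" and "pos_def B" and "pos_def \<Sigma>" and "\<epsilon> > 0"
    and "M = mat 1 - \<epsilon> *\<^sub>R upper_right_block (matrix_inv \<Sigma>)"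
    and "invertible M"
    and "F_opt = matrix_inv A **
           ((\<epsilon> / 2) *\<^sub>R mat 1 + prod_shift_sqrt A (M ** B ** transpose M) (\<epsilon>\<^sup>2 / 4))"
    and "G_opt = matrix_inv B **
           ((\<epsilon> / 2) *\<^sub>R mat 1 + prod_shift_sqrt B (transpose M ** A ** M) (\<epsilon>\<^sup>2 / 4))"
  shows "(\<forall>F G. is_arg_max (dual_objective A B M \<epsilon>) (\<lambda>(F, G). pos_def F \<and> pos_def G) (F, G)
            \<longleftrightarrow> F = F_opt \<and> G = G_opt)
         \<and> G_opt = \<epsilon> *\<^sub>R matrix_inv B + transpose M ** matrix_inv F_opt ** M"
proof -
  have "transpose (transpose (transpose M) ** B ** transpose M) = transpose (transpose M) ** B ** transpose M"
    and "x \<bullet> (transpose (transpose M) ** B ** transpose M *v x) \<ge> 0" for x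
    using assms(2) by (intro congruence_symmetric_nonneg; simp add: pos_def_transpose pos_def_inner_nonneg)+
  then have F: "pos_def F_opt" "F_opt ** A ** F_opt = \<epsilon> *\<^sub>R F_opt + M ** B ** transpose M"
    using Riccati_solution[OF assms(1) _ _ assms(4,7)] by simp_all
  have G: "G_opt = \<epsilon> *\<^sub>R matrix_inv B + transpose M ** matrix_inv F_opt ** M"
    using Riccati_dual_solution[OF assms(2) F(1) assms(4) F(2)] assms(8) by simp
  have "transpose (transpose M ** A ** M) = transpose M ** A ** M"
    and "x \<bullet> (transpose M ** A ** M *v x) \<ge> 0" for x
    using assms(1) by (intro congruence_symmetric_nonneg; simp add: pos_def_transpose pos_def_inner_nonneg)+
  then have posG: "pos_def G_opt"
    using Riccati_solution(1)[OF assms(2) _ _ assms(4,8)] by simp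
  have "pos_def (G_opt - transpose M ** matrix_inv F_opt ** M)"
    using assms(2,4) by (simp add: G pos_def_scaleR pos_def_matrix_inv)
  with F(1) have Y: "pos_def (block_matrix F_opt (- M) (- transpose M) G_opt)"
    by (rule pos_def_block_matrix_Schur)
  obtain U V where "matrix_inv (block_matrix F_opt (- M) (- transpose M) G_opt)
      = (1 / \<epsilon>) *\<^sub>R block_matrix A U V B"
    using matrix_inv_block_critical[OF assms(2) F(1) assms(4) F(2) G] by blast
  then have less: "dual_objective A B M \<epsilon> (F, G) < dual_objective A B M \<epsilon> (F_opt, G_opt)"
    if "(F, G) \<noteq> (F_opt, G_opt)" for F G
    using dual_objective_less_critical[OF assms(1,2,4) Y] that by blast
  have "is_arg_max (dual_objective A B M \<epsilon>) (\<lambda>(F, G). pos_def F \<and> pos_def G) (F_opt, G_opt)"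
    unfolding is_arg_max_def
  proof (intro conjI notI)
    assume "\<exists>y. (case y of (F, G) \<Rightarrow> pos_def F \<and> pos_def G) \<and>
        dual_objective A B M \<epsilon> (F_opt, G_opt) < dual_objective A B M \<epsilon> y"
    then obtain F G where "dual_objective A B M \<epsilon> (F_opt, G_opt) < dual_objective A B M \<epsilon> (F, G)"
      by auto
    then show False using less[of F G] by (cases "(F, G) = (F_opt, G_opt)") auto
  qed (simp add: F(1) posG)
  moreover have "(F, G) = (F_opt, G_opt)"
    if "is_arg_max (dual_objective A B M \<epsilon>) (\<lambda>(F, G). pos_def F \<and> pos_def G) (F, G)" for F G
  proof (rule ccontr)
    assume "(F, G) \<noteq> (F_opt, G_opt)"
    then have "dual_objective A B M \<epsilon> (F, G) < dual_objective A B M \<epsilon> (F_opt, G_opt)" by (rule less)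
    moreover have "case (F_opt, G_opt) of (F, G) \<Rightarrow> pos_def F \<and> pos_def G"
      by (simp add: F(1) posG)
    ultimately show False using that unfolding is_arg_max_def by blast
  qed
  ultimately show ?thesis using G by blast
qed

end
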